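(* Let $n\ge 1$ and let $\mu$ and $\nu$ be any two valid MV assignments of $A_{2n}$. On input $(A_{2n},\mu,\nu)$, the algorithm FEA-Shwoop (described in the context) outputs a finite sequence of faces of $A_{2n}$ that, when flipped in order starting from $\mu$, provides a sequence of valid MV assignments of $A_{2n}$ that starts with $\mu$ and ends with $\nu$.
   Context: $A_{2n}$ is the crease pattern with a single interior vertex of degree $2n$, creases $e_1,\dots,e_{2n}$ in cyclic order, all consecutive angles equal to $\pi/n$, and faces $\alpha_1,\dots,\alpha_{2n}$, where $\alpha_i$ is the face between $e_i$ and $e_{i+1}$ (indices cyclic mod $2n$). A mountain-valley (MV) assignment is a function $\mu:\{e_1,\dots,e_{2n}\}\to\{-1,1\}$ ($1$ = mountain, $-1$ = valley). It is valid if it can be used to fold the paper flat without self-intersection; for $A_{2n}$ this is known to be equivalent to $\sum_{i=1}^{2n}\mu(e_i)=\pm 2$, which may be taken as the definition. For a face $\alpha_i$, $\mu_{\alpha_i}$ denotes the MV assignment obtained from $\mu$ by changing the sign on exactly the two creases $e_i,e_{i+1}$ bordering $\alpha_i$ ("flipping $\alpha_i$"). The face $\alpha_i$ is flippable under a valid $\mu$ if $\mu_{\alpha_i}$ is also valid. Algorithm FEA-Shwoop$(A_{2n},\mu,\nu)$. Initialize $S$ to the empty sequence and $\eta=\mu$. For $i=1,2,\dots,2n-1$ in order, do the following. If $\eta(e_i)=\nu(e_i)$, do nothing. If $\eta(e_i)\ne\nu(e_i)$ and $\alpha_i$ is flippable under $\eta$, replace $\eta$ by $\eta_{\alpha_i}$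 and append $\alpha_i$ to $S$. If $\eta(e_i)\neq\nu(e_i)$ and $\alpha_i$ is not flippable under $\eta$, examine $\alpha_{i+1},\alpha_{i+2},\dots$ in order until the first face $\alpha_{i+m}$ that is flippable under $\eta$ is found; then successively, for $t=i+m,\,i+m-1,\,\dots,\,i$ in this order, replace $\eta$ by $\eta_{\alpha_t}$ and append $\alpha_t$ to $S$ (a "shwoop"); then continue with the next value of $i$. After the loop, output $S$. *)

theory Defs
  imports Main "HOL-Library.FuncSet" "HOL-Library.While_Combinator"
begin

text \<open>The creases \<open>e\<^sub>1, \<dots>, e\<^sub>2\<^sub>n\<close> of \<open>A\<^sub>2\<^sub>n\<close> and its faces \<open>\<alpha>\<^sub>1, \<dots>, \<alpha>\<^sub>2\<^sub>n\<close> are both represented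
  by their indices \<open>1, \<dots>, 2n\<close>.\<close>

type_synonym crease = nat
type_synonym face = nat
type_synonym mv = "crease \<Rightarrow> int"

text \<open>The representative in \<open>{1..2n}\<close> of an index \<open>i \<ge> 1\<close> read cyclically modulo \<open>2n\<close>.\<close>

definition cyc :: "nat \<Rightarrow> nat \<Rightarrow> nat" where
  "cyc n i = (i - 1) mod (2 * n) + 1"

text \<open>Assignments are extensional functions, so that equality of assignments is agreement on
  all creases.  Mountain is \<open>1\<close>, valley is \<open>-1\<close>.\<close>

definition mv_assignments :: "nat \<Rightarrow> mv set" where
  "mv_assignments n = {1..2 * n} \<rightarrow>\<^sub>E {-1, 1}"

text \<open>For \<open>A\<^sub>2\<^sub>n\<close>, where all consecutive angles are equal, flat-foldability without
  self-intersection amounts to this Maekawa-type condition, here taken as the definition.\<close>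

definition valid :: "nat \<Rightarrow> mv \<Rightarrow> bool" where
  "valid n \<mu> \<longleftrightarrow> \<mu> \<in> mv_assignments n \<and> (\<Sum>i = 1..2 * n. \<mu> i) \<in> {-2, 2}"

text \<open>The face \<open>\<alpha>\<^sub>i\<close> is bordered by \<open>e\<^sub>i\<close> and \<open>e\<^sub>i\<^sub>+\<^sub>1\<close>.\<close>

definition flip :: "nat \<Rightarrow> mv \<Rightarrow> face \<Rightarrow> mv" where
  "flip n \<mu> i = (\<lambda>k. if k \<in> {cyc n i, cyc n (i + 1)} then - \<mu> k else \<mu> k)"

definition flippable :: "nat \<Rightarrow> mv \<Rightarrow> face \<Rightarrow> bool" where
  "flippable n \<mu> i \<longleftrightarrow> valid n (flip n \<mu> i)"

text \<open>The algorithm works on states \<open>(\<eta>, S)\<close>.\<close>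

definition flip_append :: "nat \<Rightarrow> mv \<times> face list \<Rightarrow> nat \<Rightarrow> mv \<times> face list" where
  "flip_append n = (\<lambda>(\<eta>, S) t. (flip n \<eta> t, S @ [cyc n t]))"

text \<open>The search for the first flippable face among \<open>\<alpha>\<^sub>i\<^sub>+\<^sub>1, \<alpha>\<^sub>i\<^sub>+\<^sub>2, \<dots>\<close> (indices cyclic); the
  returned index is \<open>i + m\<close>, before cyclic reduction.  The result is \<open>None\<close> if the search
  runs forever.\<close>

definition find_flippable :: "nat \<Rightarrow> mv \<Rightarrow> nat \<Rightarrow> nat option" where
  "find_flippable n \<eta> i = while_option (\<lambda>j. \<not> flippable n \<eta> j) (\<lambda>j. j + 1) (i + 1)"

text \<open>Flips \<open>\<alpha>\<^sub>j, \<alpha>\<^sub>j\<^sub>-\<^sub>1, \<dots>, \<alpha>\<^sub>i\<close> in this order.\<close>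

definition shwoop :: "nat \<Rightarrow> nat \<Rightarrow> nat \<Rightarrow> mv \<times> face list \<Rightarrow> mv \<times> face list" where
  "shwoop n i j s = foldl (flip_append n) s (rev [i..<j + 1])"

definition fea_step :: "nat \<Rightarrow> mv \<Rightarrow> nat \<Rightarrow> mv \<times> face list \<Rightarrow> (mv \<times> face list) option" where
  "fea_step n \<nu> i s =
     (if fst s i = \<nu> i then Some s
      else if flippable n (fst s) i then Some (flip_append n s i)
      else map_option (\<lambda>j. shwoop n i j s) (find_flippable n (fst s) i))"

fun fea_loop :: "nat \<Rightarrow> mv \<Rightarrow> nat list \<Rightarrow> mv \<times> face list \<Rightarrow> (mv \<times> face list) option" where
  "fea_loop n \<nu> [] s = Some s"
| "fea_loop n \<nu> (i # is) s = Option.bind (fea_step n \<nu> i s) (fea_loop n \<nu> is)"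

text \<open>The output of the algorithm; \<open>None\<close> means that it does not terminate.\<close>

definition fea_shwoop :: "nat \<Rightarrow> mv \<Rightarrow> mv \<Rightarrow> face list option" where
  "fea_shwoop n \<mu> \<nu> = map_option snd (fea_loop n \<nu> [1..<2 * n] (\<mu>, []))"

text \<open>All assignments passed through, both ends included, when flipping the given faces in order.\<close>

fun flip_sequence :: "nat \<Rightarrow> mv \<Rightarrow> face list \<Rightarrow> mv list" where
  "flip_sequence n \<mu> [] = [\<mu>]"
| "flip_sequence n \<mu> (\<alpha> # S) = \<mu> # flip_sequence n (flip n \<mu> \<alpha>) S"

end

theory Submission
  imports Defs
begin

text \<open>Let \<open>\<eta>\<close> be valid with crease sum \<open>\<plusminus>2\<close>.  Flipping a face keeps the sum if its two creases
  have different signs, and otherwise changes it by \<open>4\<close>, towards the opposite sum if both creases carry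
  the majority sign and out of range if both carry the minority sign.  Hence among
  \<open>\<alpha>\<^sub>1, \<dots>, \<alpha>\<^sub>2\<^sub>n\<^sub>-\<^sub>1\<close> exactly the faces of the last kind are unflippable (lemma
  \<open>flippable_iff\<close>).  So if the algorithm
  starts a shwoop at \<open>\<alpha>\<^sub>i\<close>, then \<open>e\<^sub>i\<close> and \<open>e\<^sub>i\<^sub>+\<^sub>1\<close> carry the minority sign, and this sign runs on
  up to the first flippable face \<open>\<alpha>\<^sub>j\<close>, where \<open>e\<^sub>j\<^sub>+\<^sub>1\<close> carries the other one.  Flipping
  \<open>\<alpha>\<^sub>j, \<dots>, \<alpha>\<^sub>i\<close> transports that other sign step by step from \<open>e\<^sub>j\<^sub>+\<^sub>1\<close> down to \<open>e\<^sub>i\<close>: each flip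
  exchanges two different neighbouring signs, so that validity is never lost (lemma
  \<open>shwoop_transports\<close>).

  The crux is that the search for \<open>\<alpha>\<^sub>j\<close> stops before it wraps around to the creases already
  corrected, that is, \<open>j < 2n\<close> (lemma \<open>flippable_face_ahead\<close>).  Otherwise \<open>\<eta>\<close> would have the
  minority sign on all of \<open>e\<^sub>i, \<dots>, e\<^sub>2\<^sub>n\<close>; as \<open>\<nu>\<close> agrees with \<open>\<eta>\<close> before \<open>e\<^sub>i\<close> and differs from it
  at \<open>e\<^sub>i\<close>, the sum of \<open>\<nu>\<close> would exceed \<open>2\<close> in absolute value.

  Hence after round \<open>i\<close> the current assignment is valid and agrees with \<open>\<nu>\<close> on \<open>e\<^sub>1, \<dots>, e\<^sub>i\<close>.
  After round \<open>2n - 1\<close> the last crease agrees as well, because two valid sums differ by \<open>0\<close> or \<open>4\<close>,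
  never by \<open>2\<close>.\<close>

section \<open>Flipping a face\<close>

lemma flip_at:
  assumes "1 \<le> i" "i < 2 * n"
  shows "flip n \<eta> i = \<eta>(i := - \<eta> i, i + 1 := - \<eta> (i + 1))"
proof -
  have "cyc n i = i" "cyc n (i + 1) = i + 1"
    using assms by (auto simp: cyc_def)
  then show ?thesis by (auto simp: flip_def)
qed

lemma valid_values:
  assumes "valid n \<eta>" "1 \<le> k" "k \<le> 2 * n"
  shows "\<eta> k = 1 \<or> \<eta> k = -1"
  using assms by (auto simp: valid_def mv_assignments_def PiE_iff)

lemma sum_flip:
  assumes "1 \<le> i" "i < 2 * n"
  shows "(\<Sum>k = 1..2 * n. flip n \<eta> i k) = (\<Sum>k = 1..2 * n. \<eta> k) - 2 * (\<eta> i + \<eta> (i + 1))"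
proof -
  have split: "{1..2 * n} = insert i (insert (i + 1) ({1..2 * n} - {i, i + 1}))"
    using assms by auto
  have "(\<Sum>k\<in>{1..2 * n} - {i, i + 1}. flip n \<eta> i k) = (\<Sum>k\<in>{1..2 * n} - {i, i + 1}. \<eta> k)"
    by (intro sum.cong) (auto simp: flip_at[OF assms])
  then show ?thesis
    by (subst (1 2) split) (simp add: flip_at[OF assms])
qed

lemma flippable_iff:
  assumes "valid n \<eta>" "1 \<le> i" "i < 2 * n"
  shows "flippable n \<eta> i \<longleftrightarrow> \<eta> i \<noteq> \<eta> (i + 1) \<or> (\<Sum>k = 1..2 * n. \<eta> k) = 2 * \<eta> i"
proof -
  have "flip n \<eta> i \<in> mv_assignments n"
    using assms unfolding flip_at[OF assms(2,3)]
    by (auto simp: valid_def mv_assignments_def PiE_iff extensional_def)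
  moreover have "\<eta> i = 1 \<or> \<eta> i = -1" "\<eta> (i + 1) = 1 \<or> \<eta> (i + 1) = -1"
    using valid_values[OF assms(1)] assms(2,3) by auto
  ultimately show ?thesis
    using assms(1) unfolding flippable_def valid_def sum_flip[OF assms(2,3)] by auto
qed

section \<open>Runs of flips through valid assignments\<close>

text \<open>The part of the loop invariant that concerns the output: flipping the faces recorded so far
  leads from \<open>\<mu>\<close> to the current assignment through valid assignments only.\<close>

definition valid_run :: "nat \<Rightarrow> mv \<Rightarrow> mv \<times> face list \<Rightarrow> bool" where
  "valid_run n \<mu> s \<longleftrightarrow> set (snd s) \<subseteq> {1..2 * n}
     \<and> (\<forall>\<eta> \<in> set (flip_sequence n \<mu> (snd s)). valid n \<eta>)
     \<and> last (flip_sequence n \<mu> (snd s)) = fst s"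

lemma flip_sequence_nonempty [simp]: "flip_sequence n \<mu> S \<noteq> []"
  by (cases S) auto

lemma hd_flip_sequence: "hd (flip_sequence n \<mu> S) = \<mu>"
  by (cases S) auto

lemma flip_sequence_snoc:
  "flip_sequence n \<mu> (S @ [t]) = flip_sequence n \<mu> S @ [flip n (last (flip_sequence n \<mu> S)) t]"
  by (induction S arbitrary: \<mu>) auto

lemma valid_run_valid: "valid_run n \<mu> s \<Longrightarrow> valid n (fst s)"
  unfolding valid_run_def by (metis flip_sequence_nonempty last_in_set)

lemma fst_flip_append [simp]: "fst (flip_append n s t) = flip n (fst s) t"
  by (simp add: flip_append_def split: prod.split)

lemma valid_run_flip_append:
  assumes "valid_run n \<mu> s" "1 \<le> t" "t < 2 * n" "flippable n (fst s) t"
  shows "valid_run n \<mu> (flip_append n s t)"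
proof -
  have "cyc n t = t" using assms by (auto simp: cyc_def)
  then show ?thesis
    using assms
    by (cases s) (auto simp: valid_run_def flip_append_def flip_sequence_snoc flippable_def)
qed

section \<open>The shwoop\<close>

text \<open>By induction on \<open>j\<close>: the first flip exchanges the signs of \<open>e\<^sub>j\<close> and \<open>e\<^sub>j\<^sub>+\<^sub>1\<close>, which leaves
  a shorter shwoop of the same kind, from \<open>\<alpha>\<^sub>j\<^sub>-\<^sub>1\<close> down to \<open>\<alpha>\<^sub>i\<close>.\<close>

lemma shwoop_transports:
  assumes "i \<le> j" "1 \<le> i" "j < 2 * n" "valid_run n \<mu> s"
    and "\<forall>k \<in> {i..j}. fst s k = - fst s (j + 1)"
  shows "valid_run n \<mu> (shwoop n i j s)
    \<and> fst (shwoop n i j s) i = fst s (j + 1)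
    \<and> (\<forall>k<i. fst (shwoop n i j s) k = fst s k)"
  using assms
proof (induction j arbitrary: s rule: dec_induct)
  case base
  have "fst s i \<noteq> fst s (i + 1)"
    using base valid_values[OF valid_run_valid, of n \<mu> s "i + 1"] by auto
  then have "flippable n (fst s) i"
    using base flippable_iff[OF valid_run_valid] by auto
  moreover have "shwoop n i i s = flip_append n s i"
    by (simp add: shwoop_def)
  ultimately show ?case
    using base valid_run_flip_append[of n \<mu> s i] by (simp add: flip_at)
next
  case (step j)
  let ?s = "flip_append n s (Suc j)"
  have "fst s (Suc j) \<noteq> fst s (Suc j + 1)"
    using step valid_values[OF valid_run_valid, of n \<mu> s "Suc j + 1"] by auto
  then have "flippable n (fst s) (Suc j)"
    using flippable_iff[OF valid_run_valid[OF step.prems(3)], of "Suc j"] step.prems(2) by simp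
  then have run: "valid_run n \<mu> ?s"
    using valid_run_flip_append[OF step.prems(3), of "Suc j"] step.prems(2) by simp
  have flip: "flip n (fst s) (Suc j) = (fst s)(Suc j := - fst s (Suc j), Suc j + 1 := - fst s (Suc j + 1))"
    using step.prems(2) flip_at[of "Suc j" n] by simp
  have "fst ?s (j + 1) = fst s (Suc j + 1)"
    using step by (simp add: flip)
  moreover have "\<forall>k \<in> {i..j}. fst ?s k = - fst ?s (j + 1)"
    using step.prems by (simp add: flip)
  moreover have "shwoop n i (Suc j) s = shwoop n i j ?s"
    using step.hyps by (simp add: shwoop_def)
  moreover have "\<forall>k<i. fst ?s k = fst s k"
    using step.hyps by (simp add: flip)
  ultimately show ?case
    using step.IH[OF _ _ run] step.prems by simp
qed

section \<open>The search for a flippable face\<close>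

lemma while_option_linear_search:
  fixes a b :: nat
  assumes "a \<le> b" "P b"
  shows "\<exists>j. while_option (\<lambda>j. \<not> P j) (\<lambda>j. j + 1) a = Some j
    \<and> a \<le> j \<and> j \<le> b \<and> P j \<and> (\<forall>k \<in> {a..<j}. \<not> P k)"
  using assms
proof (induction a rule: inc_induct)
  case base
  then show ?case by (auto simp: while_option_unfold[of _ _ b])
next
  case (step a)
  show ?case
  proof (cases "P a")
    case True
    with step.hyps show ?thesis by (auto simp: while_option_unfold[of _ _ a])
  next
    case False
    from step obtain j where j: "while_option (\<lambda>j. \<not> P j) (\<lambda>j. j + 1) (Suc a) = Some j"
      "Suc a \<le> j" "j \<le> b" "P j" "\<forall>k \<in> {Suc a..<j}. \<not> P k"
      by blast
    have "\<forall>k \<in> {a..<j}. \<not> P k"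
      using j(5) False by (metis atLeastLessThan_iff le_antisym not_less_eq_eq)
    with False j show ?thesis by (auto simp: while_option_unfold[of _ _ a])
  qed
qed

lemma sign_constant_of_unflippable:
  assumes "valid n \<eta>" "1 \<le> i" "i \<le> j" "j \<le> 2 * n"
    and "\<forall>k \<in> {i..<j}. \<not> flippable n \<eta> k"
  shows "\<forall>k \<in> {i..j}. \<eta> k = \<eta> i"
  using assms(3,4,5)
proof (induction j rule: dec_induct)
  case base
  then show ?case by simp
next
  case (step j)
  have const: "\<forall>k \<in> {i..j}. \<eta> k = \<eta> i"
    by (rule step.IH) (use step.prems in auto)
  have "\<not> flippable n \<eta> j"
    using step.hyps step.prems(2) by simp
  then have "\<eta> (Suc j) = \<eta> j"
    using flippable_iff[OF assms(1), of j] step.hyps step.prems(1) assms(2) by simp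
  then have "\<eta> (Suc j) = \<eta> i"
    using bspec[OF const, of j] step.hyps by simp
  with const show ?case
    by (metis atLeastAtMost_iff le_Suc_eq)
qed

text \<open>If all faces from \<open>\<alpha>\<^sub>i\<close> to \<open>\<alpha>\<^sub>2\<^sub>n\<^sub>-\<^sub>1\<close> were unflippable, \<open>\<eta>\<close> would take its minority sign
  \<open>c\<close> at all creases from \<open>e\<^sub>i\<close> on.  Then \<open>c \<cdot> \<nu>\<close> would nowhere exceed \<open>c \<cdot> \<eta>\<close> and be
  smaller by \<open>2\<close> at \<open>e\<^sub>i\<close>; but the sum of \<open>c \<cdot> \<eta>\<close> is already the lowest possible one, \<open>-2\<close>.\<close>

lemma flippable_face_ahead:
  assumes "valid n \<eta>" "valid n \<nu>" "1 \<le> i" "i < 2 * n"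
    and agree: "\<forall>k \<in> {1..<i}. \<eta> k = \<nu> k" and differ: "\<eta> i \<noteq> \<nu> i"
    and "\<not> flippable n \<eta> i"
  shows "\<exists>j. i < j \<and> j < 2 * n \<and> flippable n \<eta> j"
proof (rule ccontr)
  assume "\<not> ?thesis"
  then have "\<forall>k \<in> {i..<2 * n}. \<not> flippable n \<eta> k"
    using assms(7) by (metis atLeastLessThan_iff le_neq_implies_less)
  then have const: "\<forall>k \<in> {i..2 * n}. \<eta> k = \<eta> i"
    by (intro sign_constant_of_unflippable) (use assms in auto)
  define c where "c = \<eta> i"
  have c: "c = 1 \<or> c = -1"
    using valid_values[OF assms(1)] assms(3,4) by (simp add: c_def)
  have "(\<Sum>k = 1..2 * n. \<eta> k) \<noteq> 2 * c"
    using assms flippable_iff by (auto simp: c_def)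
  then have sum_\<eta>: "c * (\<Sum>k = 1..2 * n. \<eta> k) = -2"
    using assms(1) c by (auto simp: valid_def)
  have sum_\<nu>: "c * (\<Sum>k = 1..2 * n. \<nu> k) \<ge> -2"
    using assms(2) c by (auto simp: valid_def)
  have gap: "0 \<le> c * (\<eta> k - \<nu> k)" if "k \<in> {1..2 * n}" for k
  proof (cases "k < i")
    case True
    then show ?thesis using agree that by auto
  next
    case False
    then have "\<eta> k = c" using bspec[OF const, of k] that by (simp add: c_def)
    then show ?thesis using c valid_values[OF assms(2), of k] that by auto
  qed
  have "c * (\<eta> i - \<nu> i) \<le> (\<Sum>k = 1..2 * n. c * (\<eta> k - \<nu> k))"
  proof (rule member_le_sum)
    show "i \<in> {1..2 * n}" using assms(3,4) by simp
  qed (use gap in \<open>blast, simp\<close>)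
  also have "\<dots> = c * (\<Sum>k = 1..2 * n. \<eta> k) - c * (\<Sum>k = 1..2 * n. \<nu> k)"
    by (simp add: sum_distrib_left right_diff_distrib sum_subtractf)
  finally have "c * (\<eta> i - \<nu> i) \<le> 0"
    using sum_\<eta> sum_\<nu> by simp
  moreover have "c * (\<eta> i - \<nu> i) = 2"
    using c differ valid_values[OF assms(2), of i] assms(3,4) by (auto simp: c_def)
  ultimately show False by simp
qed

section \<open>Correctness of the algorithm\<close>

lemma fea_step_extends_agreement:
  assumes "valid_run n \<mu> s" "valid n \<nu>" "1 \<le> i" "i < 2 * n"
    and agree: "\<forall>k \<in> {1..<i}. fst s k = \<nu> k"
  shows "\<exists>s'. fea_step n \<nu> i s = Some s' \<and> valid_run n \<mu> s' \<and> (\<forall>k \<in> {1..<Suc i}. fst s' k = \<nu> k)"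
proof -
  let ?\<eta> = "fst s"
  have valid: "valid n ?\<eta>" using assms(1) by (rule valid_run_valid)
  \<comment> \<open>As there are only two signs, a change of sign at \<open>e\<^sub>i\<close> makes it the sign of \<open>\<nu>\<close>.\<close>
  have opposite: "- ?\<eta> i = \<nu> i" if "?\<eta> i \<noteq> \<nu> i"
    using that valid_values[OF valid, of i] valid_values[OF assms(2), of i] assms(3,4) by auto
  consider "?\<eta> i = \<nu> i" | "?\<eta> i \<noteq> \<nu> i" "flippable n ?\<eta> i"
    | "?\<eta> i \<noteq> \<nu> i" "\<not> flippable n ?\<eta> i"
    by blast
  then show ?thesis
  proof cases
    case 1
    then show ?thesis
      using assms(1) agree by (auto simp: fea_step_def less_Suc_eq)
  next
    case 2
    then show ?thesis
      using valid_run_flip_append[OF assms(1,3,4)] opposite agree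
      by (auto simp: fea_step_def flip_at[OF assms(3,4)] less_Suc_eq)
  next
    case 3
    obtain b where b: "i + 1 \<le> b" "b < 2 * n" "flippable n ?\<eta> b"
      using flippable_face_ahead[OF valid assms(2-4) agree 3] by (metis Suc_eq_plus1 Suc_leI)
    obtain j where find: "find_flippable n ?\<eta> i = Some j"
      and j: "i + 1 \<le> j" "j \<le> b" "flippable n ?\<eta> j" "\<forall>k \<in> {i + 1..<j}. \<not> flippable n ?\<eta> k"
      using while_option_linear_search[of "i + 1" b "flippable n ?\<eta>", OF b(1,3)]
      unfolding find_flippable_def by blast
    have "\<forall>k \<in> {i..<j}. \<not> flippable n ?\<eta> k"
      using j(4) 3(2) by (metis atLeastLessThan_iff le_neq_implies_less Suc_eq_plus1 Suc_leI)
    then have const: "\<forall>k \<in> {i..j}. ?\<eta> k = ?\<eta> i"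
      by (intro sign_constant_of_unflippable[OF valid assms(3)]) (use j b in auto)
    \<comment> \<open>The common sign of \<open>e\<^sub>i, \<dots>, e\<^sub>j\<close> is the minority sign, so \<open>\<alpha>\<^sub>j\<close> can only be flippable
      because its two creases differ.\<close>
    have "(\<Sum>k = 1..2 * n. ?\<eta> k) \<noteq> 2 * ?\<eta> i"
      using flippable_iff[OF valid assms(3,4)] 3(2) by blast
    moreover have "?\<eta> j = ?\<eta> i"
      using bspec[OF const, of j] j(1) by simp
    ultimately have "?\<eta> i \<noteq> ?\<eta> (j + 1)"
      using flippable_iff[OF valid, of j] j(1-3) b(2) by simp
    then have "?\<eta> i = - ?\<eta> (j + 1)"
      using valid_values[OF valid, of i] valid_values[OF valid, of "j + 1"] j(1,2) b(2) assms(3,4)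
      by auto
    then have "\<forall>k \<in> {i..j}. ?\<eta> k = - ?\<eta> (j + 1)" "?\<eta> (j + 1) = \<nu> i"
      using const opposite[OF 3(1)] by (metis, simp)
    then have "valid_run n \<mu> (shwoop n i j s)
      \<and> fst (shwoop n i j s) i = \<nu> i \<and> (\<forall>k<i. fst (shwoop n i j s) k = ?\<eta> k)"
      using shwoop_transports[of i j n \<mu> s] j(1,2) b(2) assms(1,3) by simp
    then show ?thesis
      using 3 find agree by (auto simp: fea_step_def less_Suc_eq)
  qed
qed

lemma fea_loop_reaches_agreement:
  assumes "i \<le> 2 * n" "1 \<le> i" "valid n \<nu>" "valid_run n \<mu> s" "\<forall>k \<in> {1..<i}. fst s k = \<nu> k"
  shows "\<exists>s'. fea_loop n \<nu> [i..<2 * n] s = Some s' \<and> valid_run n \<mu> s'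
    \<and> (\<forall>k \<in> {1..<2 * n}. fst s' k = \<nu> k)"
  using assms
proof (induction i arbitrary: s rule: inc_induct)
  case base
  then show ?case by simp
next
  case (step i)
  obtain s' where "fea_step n \<nu> i s = Some s'" "valid_run n \<mu> s'"
    "\<forall>k \<in> {1..<Suc i}. fst s' k = \<nu> k"
    using fea_step_extends_agreement[OF step.prems(3,2,1) step.hyps(2) step.prems(4)] by blast
  then show ?case
    using step.IH[of s'] step.hyps step.prems by (simp add: upt_conv_Cons)
qed

lemma valid_eq_if_agree_but_last:
  assumes "n \<ge> 1" "valid n \<eta>" "valid n \<nu>" and agree: "\<forall>k \<in> {1..<2 * n}. \<eta> k = \<nu> k"
  shows "\<eta> = \<nu>"
proof -
  have split: "{1..2 * n} = insert (2 * n) {1..<2 * n}"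
    using assms(1) by auto
  have "(\<Sum>k = 1..2 * n. \<eta> k) - \<eta> (2 * n) = (\<Sum>k = 1..2 * n. \<nu> k) - \<nu> (2 * n)"
    unfolding split using agree by simp
  moreover have "(\<Sum>k = 1..2 * n. \<eta> k) \<in> {-2, 2}" "(\<Sum>k = 1..2 * n. \<nu> k) \<in> {-2, 2}"
    using assms by (auto simp: valid_def)
  ultimately have last: "\<eta> (2 * n) = \<nu> (2 * n)"
    using valid_values[OF assms(2), of "2 * n"] valid_values[OF assms(3), of "2 * n"] assms(1)
    by auto
  have "\<eta> \<in> {1..2 * n} \<rightarrow>\<^sub>E {-1, 1}" "\<nu> \<in> {1..2 * n} \<rightarrow>\<^sub>E {-1, 1}"
    using assms(2,3) by (auto simp: valid_def mv_assignments_def)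
  then show ?thesis
  proof (rule PiE_ext)
    show "\<eta> k = \<nu> k" if "k \<in> {1..2 * n}" for k
      using that agree last unfolding split by auto
  qed
qed

theorem theorem3p1:
  fixes n :: nat and \<mu> \<nu> :: mv
  assumes "n \<ge> 1" and "valid n \<mu>" and "valid n \<nu>"
  shows "\<exists>S. fea_shwoop n \<mu> \<nu> = Some S
           \<and> set S \<subseteq> {1..2 * n}
           \<and> (\<forall>\<eta> \<in> set (flip_sequence n \<mu> S). valid n \<eta>)
           \<and> hd (flip_sequence n \<mu> S) = \<mu>
           \<and> last (flip_sequence n \<mu> S) = \<nu>"
proof -
  have "valid_run n \<mu> (\<mu>, [])"
    using assms(2) by (simp add: valid_run_def)
  then obtain s where s: "fea_loop n \<nu> [1..<2 * n] (\<mu>, []) = Some s" "valid_run n \<mu> s"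
    "\<forall>k \<in> {1..<2 * n}. fst s k = \<nu> k"
    using fea_loop_reaches_agreement[of 1 n \<nu> \<mu> "(\<mu>, [])"] assms by auto
  have "fst s = \<nu>"
    using valid_eq_if_agree_but_last[OF assms(1) valid_run_valid[OF s(2)] assms(3) s(3)] .
  then show ?thesis
    using s by (auto simp: fea_shwoop_def valid_run_def hd_flip_sequence)
qed

end
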